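(* Let $G$ be a graph on vertex set $\{1,\dots,n\}$ with an automorphism $\phi$ of order $p^N$ for a prime $p$ and $N\ge 1$, and let $M$ be an $n\times n$ automorphism compatible matrix on $G$. For $i=1,\dots,N$ let $r_i$ be the number of orbits of $\phi$ of length at least $p^{N-i+1}$. Then $M$ is similar (via an explicitly constructible invertible matrix) to \[ M_\phi\oplus\hat M_1\oplus\hat M_2\oplus\cdots\oplus\hat M_N, \] where $M_\phi$ is the divisor matrix of $M$ associated with the partition of $V(G)$ into orbits of $\phi$, and for each $i$, $\hat M_i={}_iB_1\oplus{}_iB_2\oplus\cdots\oplus{}_iB_{p^{N-i+1}-p^{N-i}}$ with each ${}_iB_j$ an $r_i\times r_i$ matrix.
   Context: An automorphism of a graph $G$ is a bijection of $V(G)$ preserving adjacency (and edge weights, if weighted). An $n\times n$ matrix $M$ is automorphism compatible on $G$ if $M_{\psi(i),\psi(j)}=M_{i,j}$ for every automorphism $\psi$ of $G$ and all $i,j$. The orbits of $\phi$ are the classes $\{\phi^j(v):j\ge 0\}$. For a partition $V(G)=V_1\cup\cdots\cup V_k$ such that $\sum_{t\in V_j}M_{s,t}$ is the same number $D_{i,j}$ for every $s\in V_i$ (an equitable partition; the orbits of $\phi$ form one when $M$ is automorphism compatible), the $k\times k$ matrix $D=(D_{i,j})$ is the divisor matrix. $\oplus$ is the block-diagonal direct sum. *)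

theory Defs
  imports
    Complex_Main
    "HOL-Library.Indicator_Function"
    "HOL-Library.Disjoint_Sets"
    "HOL-Computational_Algebra.Primes"
    "Graph_Theory.Pair_Digraph"
    "Jordan_Normal_Form.Matrix"
begin

text \<open>
  Graphs are possibly directed and may have loops; an undirected edge is a pair of opposite arcs.
  Edge weights are given by a separate function on arcs. An unweighted graph is one with constant
  weight, for instance with weights of type \<^typ>\<open>unit\<close>. Matrix rows and columns are numbered
  from \<open>0\<close>, so the vertex set is \<open>{..<n}\<close> instead of \<open>{1..n}\<close>.
\<close>

definition graph_automorphism ::
  "'a pair_pre_digraph \<Rightarrow> ('a \<times> 'a \<Rightarrow> 'w) \<Rightarrow> ('a \<Rightarrow> 'a) \<Rightarrow> bool" where
  "graph_automorphism G w \<psi> \<longleftrightarrow>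
     bij_betw \<psi> (pverts G) (pverts G) \<and>
     (\<forall>u\<in>pverts G. \<forall>v\<in>pverts G. (\<psi> u, \<psi> v) \<in> parcs G \<longleftrightarrow> (u, v) \<in> parcs G) \<and>
     (\<forall>(u, v)\<in>parcs G. w (\<psi> u, \<psi> v) = w (u, v))"

text \<open>The values of \<open>\<phi>\<close> outside the vertex set \<open>V\<close> are irrelevant, here and below.\<close>

definition automorphism_order :: "'a set \<Rightarrow> ('a \<Rightarrow> 'a) \<Rightarrow> nat" where
  "automorphism_order V \<phi> = (LEAST k. 0 < k \<and> (\<forall>v\<in>V. (\<phi> ^^ k) v = v))"

definition automorphism_compatible ::
  "nat pair_pre_digraph \<Rightarrow> (nat \<times> nat \<Rightarrow> 'w) \<Rightarrow> 'c mat \<Rightarrow> bool" where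
  "automorphism_compatible G w M \<longleftrightarrow>
     (\<forall>\<psi>. graph_automorphism G w \<psi> \<longrightarrow>
       (\<forall>i\<in>pverts G. \<forall>j\<in>pverts G. M $$ (\<psi> i, \<psi> j) = M $$ (i, j)))"

definition vertex_orbit :: "('a \<Rightarrow> 'a) \<Rightarrow> 'a \<Rightarrow> 'a set" where
  "vertex_orbit \<phi> v = {(\<phi> ^^ j) v | j. True}"

definition vertex_orbits :: "'a set \<Rightarrow> ('a \<Rightarrow> 'a) \<Rightarrow> 'a set set" where
  "vertex_orbits V \<phi> = vertex_orbit \<phi> ` V"

text \<open>
  \<open>is_divisor_matrix n M Vs D\<close>: the list \<open>Vs = [V\<^sub>1, \<dots>, V\<^sub>k]\<close> is an equitable partition
  of the vertex set with respect to \<open>M\<close>, and \<open>D\<close> is its divisor matrix. The cells are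
  nonempty, so \<open>D\<close> is unique.
\<close>

definition is_divisor_matrix ::
  "nat \<Rightarrow> 'c::comm_monoid_add mat \<Rightarrow> nat set list \<Rightarrow> 'c mat \<Rightarrow> bool" where
  "is_divisor_matrix n M Vs D \<longleftrightarrow>
     distinct Vs \<and> partition_on {..<n} (set Vs) \<and>
     D \<in> carrier_mat (length Vs) (length Vs) \<and>
     (\<forall>i<length Vs. \<forall>j<length Vs. \<forall>s\<in>Vs ! i. (\<Sum>t\<in>Vs ! j. M $$ (s, t)) = D $$ (i, j))"

text \<open>
  The explicit change of basis. With \<open>\<omega> = exp (2 \<pi> \<i> / m)\<close>, the vector
  \<open>orbit_fourier_vec n \<phi> m a V\<close> is supported on the orbit \<open>V\<close> and has entry
  \<open>\<omega> ^ (a t)\<close> at the vertex \<open>\<phi> ^ t (Min V)\<close>; it is used when \<open>m\<close> divides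
  the length of \<open>V\<close>, so that the entry does not depend on the choice of \<open>t\<close>.
\<close>

definition orbit_fourier_vec ::
  "nat \<Rightarrow> (nat \<Rightarrow> nat) \<Rightarrow> nat \<Rightarrow> nat \<Rightarrow> nat set \<Rightarrow> complex vec" where
  "orbit_fourier_vec n \<phi> m a V = vec n (\<lambda>v.
     if v \<in> V
     then cis (2 * pi / real m) ^ (a * (LEAST t. (\<phi> ^^ t) (Min V) = v))
     else 0)"

text \<open>
  The first columns are the indicator vectors of the orbits. They are followed, for each
  \<open>i = 1, \<dots>, N\<close> and each primitive \<open>p ^ (N - i + 1)\<close>-th root of unity \<open>\<omega> ^ a\<close>,
  by the vectors above for the \<open>r\<^sub>i\<close> orbits of length at least \<open>p ^ (N - i + 1)\<close>.
\<close>

definition orbit_basis_matrix ::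
  "nat \<Rightarrow> nat \<Rightarrow> nat \<Rightarrow> (nat \<Rightarrow> nat) \<Rightarrow> nat set list \<Rightarrow> complex mat" where
  "orbit_basis_matrix n p N \<phi> Vs = mat_of_cols n
     (map (\<lambda>V. vec n (indicator V)) Vs @
      [orbit_fourier_vec n \<phi> (p ^ (N - i + 1)) a V.
         i \<leftarrow> [1..<N + 1],
         a \<leftarrow> filter (\<lambda>a. coprime a p) [1..<p ^ (N - i + 1)],
         V \<leftarrow> filter (\<lambda>V. card V \<ge> p ^ (N - i + 1)) Vs])"

end

theory Submission
  imports
    Defs
    "HOL-Combinatorics.Cycles"
    "HOL-Number_Theory.Totient"
    "Jordan_Normal_Form.Determinant"
begin

text \<open>
  A matrix compatible with \<open>\<phi>\<close> commutes with the shift \<open>f \<mapsto> f \<circ> \<phi>\<close>, so it preserves the eigenspaces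
  of the shift. The eigenspace of a primitive \<open>m\<close>-th root of unity \<open>\<omega>\<close> is spanned by the vectors
  \<open>\<phi>\<^sup>t (Min V) \<mapsto> \<omega>\<^sup>t\<close> supported on the orbits \<open>V\<close> whose length is divisible by \<open>m\<close>; for prime power
  order this means length at least \<open>m\<close>. The blocks are the restrictions of \<open>M\<close> to these
  eigenspaces, and \<open>\<omega> = 1\<close> gives the divisor matrix. All these vectors are pairwise orthogonal, and
  there are \<open>n\<close> of them because \<open>\<Sum>m | m dvd c. totient m = c\<close> for each orbit length \<open>c\<close>.
\<close>

section \<open>Roots of unity and totients\<close>

lemma cis_root_power_eq_1_iff:
  fixes m k :: nat
  assumes "m > 0"
  shows "cis (2 * pi / real m) ^ k = 1 \<longleftrightarrow> m dvd k"
proof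
  assume "m dvd k"
  then obtain l where "k = m * l" by blast
  then have "real k * (2 * pi / real m) = 2 * pi * real l"
    using assms by simp
  then show "cis (2 * pi / real m) ^ k = 1"
    by (simp only: DeMoivre) simp
next
  assume "cis (2 * pi / real m) ^ k = 1"
  \<comment> \<open>The real part alone suffices, since \<open>cos x = 1\<close> already forces
    \<open>x\<close> to be an integer multiple of 2 pi.\<close>
  then have "cos (real k * (2 * pi / real m)) = 1"
    by (metis DeMoivre cis.simps(1) one_complex.simps(1))
  then obtain i :: int where "real k * (2 * pi / real m) = real_of_int i * 2 * pi"
    unfolding cos_one_2pi_int by blast
  then have "real k = real m * real_of_int i"
    using assms by (simp add: field_simps)
  then have "int k = int m * i"
    by (metis of_int_eq_iff of_int_mult of_int_of_nat_eq)
  then show "m dvd k"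
    by (metis dvd_triv_left int_dvd_int_iff)
qed

text \<open>Coprimality lets \<open>a\<close> be cancelled from \<open>m dvd a * k\<close>. The case
  \<open>a = 0\<close> is included exactly when \<open>m = 1\<close>, so the root 1 counts as
  primitive of order 1.\<close>

lemma primitive_root_power_eq_1_iff:
  assumes "m > 0" "coprime a m"
  shows "(cis (2 * pi / real m) ^ a) ^ k = 1 \<longleftrightarrow> m dvd k"
  using assms
  by (simp add: cis_root_power_eq_1_iff coprime_commute coprime_dvd_mult_right_iff
      flip: power_mult)

text \<open>The multiplicative order of the root determines \<open>m\<close>; after that the
  exponents below \<open>m\<close> enumerate the \<open>m\<close>-th roots of unity without
  repetition.\<close>

lemma primitive_root_inject:
  assumes "a < m" "coprime a m" "a' < m'" "coprime a' m'"
    and eq: "cis (2 * pi / real m) ^ a = cis (2 * pi / real m') ^ a'"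
  shows "m = m' \<and> a = a'"
proof -
  have "m dvd k \<longleftrightarrow> m' dvd k" for k
    using primitive_root_power_eq_1_iff[of m a k] primitive_root_power_eq_1_iff[of m' a' k] assms
    by simp
  then have m: "m' = m"
    by (meson dvd_antisym dvd_refl)
  have "cis (2 * pi * real a / real m) = cis (2 * pi * real a' / real m)"
    using eq unfolding m DeMoivre by (simp add: ac_simps)
  then have "a = a'"
    using inj_onD[OF bij_betw_imp_inj_on[OF bij_betw_roots_unity[of m]]] assms(1,3) m by simp
  then show ?thesis using m by simp
qed

text \<open>Residues start at 0 here, while \<open>totatives\<close> start at 1. The two sets differ
  only for \<open>m = 1\<close>, where they are {0} and {1}.\<close>

lemma card_coprime_less_eq_totient:
  assumes "m > 0"
  shows "card {a. a < m \<and> coprime a m} = totient m"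
proof (cases "m = 1")
  case True
  then have "{a. a < m \<and> coprime a m} = {0}"
    by auto
  with True show ?thesis
    by simp
next
  case False
  then have "{a. a < m \<and> coprime a m} = totatives m"
    using assms totatives_less[of _ m] by (auto simp: totatives_def intro: Nat.gr0I)
  then show ?thesis
    by (simp add: totient_def)
qed

text \<open>With \<open>k = N - i + 1\<close> this is the number of blocks in the i-th summand: one
  for each primitive \<open>p ^ k\<close>-th root of unity.\<close>

lemma length_coprime_prime_power:
  assumes "prime p" "k > 0"
  shows "length (filter (\<lambda>a. coprime a p) [1..<p ^ k]) = p ^ k - p ^ (k - 1)"
proof -
  have p1: "p ^ k > 1"
    using assms prime_gt_1_nat one_less_power by blast
  have "length (filter (\<lambda>a. coprime a p) [1..<p ^ k]) =
      card (set (filter (\<lambda>a. coprime a p) [1..<p ^ k]))"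
    by (intro distinct_card[symmetric]) simp
  also have "set (filter (\<lambda>a. coprime a p) [1..<p ^ k]) = totatives (p ^ k)"
    using assms totatives_less[OF _ p1] by (auto simp: totatives_def)
  also have "card \<dots> = p ^ (k - 1) * (p - 1)"
    using totient_prime_power[OF assms] by (simp add: totient_def)
  also have "\<dots> = p ^ k - p ^ (k - 1)"
    using assms(2) by (cases k) (simp_all add: diff_mult_distrib2 mult.commute)
  finally show ?thesis .
qed

section \<open>Orbits\<close>

lemma funpow_eq_iff_mod_least_power:
  assumes "(f ^^ P) x = x" "P > 0"
  shows "(f ^^ s) x = (f ^^ t) x \<longleftrightarrow> s mod least_power f x = t mod least_power f x"
proof -
  let ?c = "least_power f x"
  have c: "(f ^^ ?c) x = x" "?c > 0"
    using least_powerI assms by metis+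
  show ?thesis
  proof
    assume "s mod ?c = t mod ?c"
    then show "(f ^^ s) x = (f ^^ t) x"
      using funpow_mod_eq[OF c(1)] by metis
  next
    assume eq: "(f ^^ s) x = (f ^^ t) x"
    \<comment> \<open>Injectivity of \<open>f\<close> is not assumed, so \<open>s\<close> steps
      cannot be undone directly. Instead \<open>k\<close> further steps complete them to a multiple
      of the cycle length.\<close>
    define k where "k = ?c * s - s"
    have k: "k + s = ?c * s"
      using c(2) by (simp add: k_def)
    have "(f ^^ (k + t)) x = (f ^^ (?c * s)) x"
      unfolding k[symmetric] funpow_add using eq by simp
    also have "\<dots> = (f ^^ (?c * s mod ?c)) x"
      using funpow_mod_eq[OF c(1)] by metis
    finally have "(f ^^ (k + t)) x = x"
      by simp
    then have "?c dvd k + t"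
      by (rule least_power_minimal)
    then have "(k + t) mod ?c = (k + s) mod ?c"
      by (simp add: k)
    then show "s mod ?c = t mod ?c"
      by (metis cong_add_lcancel_nat cong_def)
  qed
qed

lemma vertex_orbit_eq_image:
  assumes "(f ^^ P) x = x" "P > 0"
  shows "vertex_orbit f x = (\<lambda>t. (f ^^ t) x) ` {..<least_power f x}"
    and "inj_on (\<lambda>t. (f ^^ t) x) {..<least_power f x}"
    and "card (vertex_orbit f x) = least_power f x"
proof -
  have c: "(f ^^ least_power f x) x = x" "least_power f x > 0"
    using least_powerI assms by metis+
  show *: "vertex_orbit f x = (\<lambda>t. (f ^^ t) x) ` {..<least_power f x}"
  proof -
    have "(f ^^ t) x \<in> (\<lambda>t. (f ^^ t) x) ` {..<least_power f x}" for t
      using funpow_mod_eq[OF c(1), of t] c(2) by (metis imageI lessThan_iff mod_less_divisor)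
    then show ?thesis
      unfolding vertex_orbit_def by blast
  qed
  show **: "inj_on (\<lambda>t. (f ^^ t) x) {..<least_power f x}"
    using funpow_eq_iff_mod_least_power[OF assms] by (auto simp: inj_on_def)
  show "card (vertex_orbit f x) = least_power f x"
    unfolding * by (simp add: card_image[OF **])
qed

lemma vertex_orbit_refl: "x \<in> vertex_orbit f x"
  unfolding vertex_orbit_def by (auto intro: exI[of _ 0])

lemma vertex_orbit_cong:
  assumes "(f ^^ P) x = x" "P > 0" "y \<in> vertex_orbit f x"
  shows "vertex_orbit f y = vertex_orbit f x"
proof -
  have c: "(f ^^ least_power f x) x = x" "least_power f x > 0"
    using least_powerI assms(1,2) by metis+
  from assms obtain s where s: "y = (f ^^ s) x" "s < least_power f x"
    unfolding vertex_orbit_eq_image(1)[OF assms(1,2)] by blast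
  have 1: "(f ^^ t) y = (f ^^ (t + s)) x" for t
    by (simp add: s funpow_add)
  \<comment> \<open>From \<open>y\<close> the remaining \<open>least_power f x - s\<close> steps
    close the cycle and return to \<open>x\<close>.\<close>
  have 2: "(f ^^ t) x = (f ^^ (t + (least_power f x - s))) y" for t
  proof -
    have "t + (least_power f x - s) + s = t + least_power f x"
      using s(2) by simp
    then show ?thesis
      unfolding 1 by (simp add: funpow_add c(1))
  qed
  show ?thesis
  proof (intro equalityI subsetI)
    fix z assume "z \<in> vertex_orbit f y"
    then obtain t where "z = (f ^^ t) y"
      by (auto simp: vertex_orbit_def)
    then have "z = (f ^^ (t + s)) x"
      by (simp only: 1)
    then show "z \<in> vertex_orbit f x"
      unfolding vertex_orbit_def by blast
  next
    fix z assume "z \<in> vertex_orbit f x"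
    then obtain t where "z = (f ^^ t) x"
      by (auto simp: vertex_orbit_def)
    then have "z = (f ^^ (t + (least_power f x - s))) y"
      by (simp only: 2)
    then show "z \<in> vertex_orbit f y"
      unfolding vertex_orbit_def by blast
  qed
qed

lemma automorphism_order_period:
  assumes "finite V" "bij_betw \<phi> V V" "v \<in> V"
  shows "(\<phi> ^^ automorphism_order V \<phi>) v = v"
proof -
  \<comment> \<open>Since \<phi> is arbitrary outside \<open>V\<close>, it is replaced there by the
    identity. This gives a permutation of finite support, hence a positive exponent for which
    \<open>LEAST\<close> is meaningful.\<close>
  define f where "f v = (if v \<in> V then \<phi> v else v)" for v
  have "f permutes V"
  proof (rule bij_imp_permutes)
    show "bij_betw f V V"
      using assms(2) bij_betw_cong[of V f \<phi> V] by (simp add: f_def)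
  qed (simp add: f_def)
  then have "permutation f"
    using assms(1) unfolding permutation_permutes by blast
  then obtain k where k: "f ^^ k = id" "k > 0"
    by (rule permutation_is_nilpotent)
  have "(f ^^ j) v = (\<phi> ^^ j) v \<and> (\<phi> ^^ j) v \<in> V" if "v \<in> V" for v j
    using that assms(2) by (induction j) (auto simp: f_def bij_betw_apply)
  then have "\<forall>v\<in>V. (\<phi> ^^ k) v = v"
    using k(1) by (metis id_apply)
  then have "0 < automorphism_order V \<phi> \<and> (\<forall>v\<in>V. (\<phi> ^^ automorphism_order V \<phi>) v = v)"
    unfolding automorphism_order_def using k(2)
    by (intro LeastI[of "\<lambda>k. 0 < k \<and> (\<forall>v\<in>V. (\<phi> ^^ k) v = v)" k]) simp
  then show ?thesis
    using assms(3) by blast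
qed

section \<open>Block decompositions\<close>

text \<open>\<open>B\<close> describes the action of \<open>M\<close> on the span of
  \<open>cs\<close> in terms of \<open>cs\<close>. Independence of the columns is treated
  separately, once all of them are collected.\<close>

definition invariant_cols :: "nat \<Rightarrow> 'c::semiring_0 mat \<Rightarrow> 'c vec list \<Rightarrow> 'c mat \<Rightarrow> bool" where
  "invariant_cols n M cs B \<longleftrightarrow>
     B \<in> carrier_mat (length cs) (length cs) \<and> M * mat_of_cols n cs = mat_of_cols n cs * B"

text \<open>The two lower blocks have no rows. This form makes block multiplication applicable to
  matrices placed side by side.\<close>

lemma mat_of_cols_append:
  "mat_of_cols n (xs @ ys) = four_block_mat (mat_of_cols n xs) (mat_of_cols n ys)
     (0\<^sub>m 0 (length xs)) (0\<^sub>m 0 (length ys))"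
  by (rule eq_matI) (auto simp: mat_of_cols_index nth_append four_block_mat_def Let_def)

lemma invariant_cols_append:
  assumes M: "M \<in> carrier_mat n n"
    and "invariant_cols n M xs A" "invariant_cols n M ys B"
  shows "invariant_cols n M (xs @ ys)
    (four_block_mat A (0\<^sub>m (length xs) (length ys)) (0\<^sub>m (length ys) (length xs)) B)"
proof -
  let ?X = "mat_of_cols n xs" and ?Y = "mat_of_cols n ys"
  have A: "A \<in> carrier_mat (length xs) (length xs)" "M * ?X = ?X * A"
    and B: "B \<in> carrier_mat (length ys) (length ys)" "M * ?Y = ?Y * B"
    using assms by (auto simp: invariant_cols_def)
  have X: "?X \<in> carrier_mat n (length xs)" and Y: "?Y \<in> carrier_mat n (length ys)"
    by auto
  \<comment> \<open>\<open>M\<close> is padded with empty blocks to match the shape of the appended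
    columns.\<close>
  have M4: "M = four_block_mat M (0\<^sub>m n 0) (0\<^sub>m 0 n) (0\<^sub>m 0 0)"
    using M by (auto intro!: eq_matI simp: four_block_mat_def Let_def)
  have "M * mat_of_cols n (xs @ ys) =
      four_block_mat (M * ?X) (M * ?Y) (0\<^sub>m 0 (length xs)) (0\<^sub>m 0 (length ys))"
    unfolding mat_of_cols_append
    by (subst M4, subst mult_four_block_mat[OF M zero_carrier_mat zero_carrier_mat
          zero_carrier_mat X Y zero_carrier_mat zero_carrier_mat])
      (use M X Y in \<open>auto intro!: cong_four_block_mat eq_matI simp: scalar_prod_def\<close>)
  also have "\<dots> = mat_of_cols n (xs @ ys) *
      four_block_mat A (0\<^sub>m (length xs) (length ys)) (0\<^sub>m (length ys) (length xs)) B"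
    unfolding mat_of_cols_append A B
    by (subst mult_four_block_mat[OF X Y _ _ A(1) _ _ B(1)])
      (use A(1) B(1) X Y in \<open>auto intro!: cong_four_block_mat simp: right_mult_zero_mat[OF X]
         right_mult_zero_mat[OF Y]\<close>)
  finally show ?thesis
    using A B by (auto simp: invariant_cols_def)
qed

text \<open>Invariance of each family of columns combines into one identity
  \<open>M * T = T * D\<close> with \<open>D\<close> block diagonal.\<close>

lemma invariant_cols_concat:
  assumes M: "M \<in> carrier_mat n n"
    and "list_all2 (invariant_cols n M) css Bs"
  shows "invariant_cols n M (concat css) (diag_block_mat Bs)"
  using assms(2)
proof induction
  case Nil
  then show ?case
    using M by (auto simp: invariant_cols_def intro!: eq_matI)
next
  case (Cons xs css A Bs)
  have d: "dim_row A = length xs" "dim_col A = length xs"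
    "dim_row (diag_block_mat Bs) = length (concat css)"
    "dim_col (diag_block_mat Bs) = length (concat css)"
    using Cons by (auto simp: invariant_cols_def)
  show ?case
    using invariant_cols_append[OF M Cons.hyps(1) Cons.IH] d by (simp add: Let_def)
qed

lemma distinct_concat_map_Pair:
  "distinct xs \<Longrightarrow> (\<And>x. x \<in> set xs \<Longrightarrow> distinct (g x)) \<Longrightarrow>
    distinct (concat (map (\<lambda>x. map (Pair x) (g x)) xs))"
  by (induction xs) (auto simp: distinct_map inj_on_def)

lemma concat_concat: "concat (concat xsss) = concat (map concat xsss)"
  by (induction xsss) auto

text \<open>Reconciles blocks numbered from 1 with list positions numbered from 0.\<close>

lemma map_nth_shift: "map (\<lambda>j. f (xs ! (j - 1))) [1..<length xs + 1] = map f xs"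
  by (rule nth_equalityI) (auto simp del: upt_Suc)

section \<open>The orbit basis\<close>

locale prime_power_permutation =
  fixes n p N :: nat and \<phi> :: "nat \<Rightarrow> nat" and Vs :: "nat set list"
  assumes p: "prime p"
    and bij: "bij_betw \<phi> {..<n} {..<n}"
    and period: "\<And>v. v < n \<Longrightarrow> (\<phi> ^^ (p ^ N)) v = v"
    and distinct_Vs: "distinct Vs"
    and set_Vs: "set Vs = vertex_orbits {..<n} \<phi>"
begin

abbreviation F :: "nat \<Rightarrow> nat \<Rightarrow> nat set \<Rightarrow> complex vec" where
  "F \<equiv> orbit_fourier_vec n \<phi>"

abbreviation \<omega> :: "nat \<Rightarrow> nat \<Rightarrow> complex" where
  "\<omega> m a \<equiv> cis (2 * pi / real m) ^ a"

section \<open>Cyclic structure of the orbits\<close>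

lemma order_pos: "p ^ N > 0"
  using prime_gt_0_nat[OF p] by simp

lemma map_less: "v < n \<Longrightarrow> \<phi> v < n"
  using bij_betwE[OF bij] by auto

lemma funpow_less: "v < n \<Longrightarrow> (\<phi> ^^ t) v < n"
  by (induction t) (auto simp: map_less)

lemma orbit_of_mem:
  assumes "V \<in> set Vs" "v \<in> V"
  shows "v < n" "V = vertex_orbit \<phi> v"
proof -
  obtain u where u: "u < n" "V = vertex_orbit \<phi> u"
    using assms(1) set_Vs by (auto simp: vertex_orbits_def)
  show "v < n"
    using assms(2) u funpow_less by (auto simp: vertex_orbit_def)
  show "V = vertex_orbit \<phi> v"
    using vertex_orbit_cong[OF period[OF u(1)] order_pos] assms(2) u by simp
qed

lemma orbit_mem: "v < n \<Longrightarrow> vertex_orbit \<phi> v \<in> set Vs"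
  using set_Vs by (auto simp: vertex_orbits_def)

lemma orbit_finite: "V \<in> set Vs \<Longrightarrow> finite V"
  by (rule finite_subset[of _ "{..<n}"]) (auto intro: orbit_of_mem(1))

lemma Min_mem:
  assumes "V \<in> set Vs"
  shows "Min V \<in> V"
proof (rule Min_in[OF orbit_finite[OF assms]])
  show "V \<noteq> {}"
    using assms set_Vs vertex_orbit_refl by (fastforce simp: vertex_orbits_def)
qed

lemma orbits_disjoint:
  assumes "V \<in> set Vs" "W \<in> set Vs" "v \<in> V" "v \<in> W"
  shows "V = W"
  by (rule trans[OF orbit_of_mem(2)[OF assms(1,3)] orbit_of_mem(2)[OF assms(2,4), symmetric]])

text \<open>With base point \<open>Min V\<close>, an orbit is a copy of the integers modulo
  \<open>card V\<close> on which \<phi> adds 1.\<close>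

lemma
  assumes "V \<in> set Vs"
  shows orbit_eq_image: "V = (\<lambda>t. (\<phi> ^^ t) (Min V)) ` {..<card V}"
    and orbit_inj_on: "inj_on (\<lambda>t. (\<phi> ^^ t) (Min V)) {..<card V}"
    and funpow_Min_eq_iff:
      "(\<phi> ^^ s) (Min V) = (\<phi> ^^ t) (Min V) \<longleftrightarrow> s mod card V = t mod card V"
    and card_orbit_dvd: "card V dvd p ^ N"
    and funpow_Min_mem: "(\<phi> ^^ t) (Min V) \<in> V"
    and funpow_Min_less: "(\<phi> ^^ t) (Min V) < n"
proof -
  note o = orbit_of_mem[OF assms Min_mem[OF assms]]
  note per = period[OF o(1)] order_pos
  have c: "card V = least_power \<phi> (Min V)"
    using vertex_orbit_eq_image(3)[OF per] o(2) by simp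
  show "V = (\<lambda>t. (\<phi> ^^ t) (Min V)) ` {..<card V}"
    using vertex_orbit_eq_image(1)[OF per] o(2) c by simp
  show "inj_on (\<lambda>t. (\<phi> ^^ t) (Min V)) {..<card V}"
    using vertex_orbit_eq_image(2)[OF per] c by simp
  show "(\<phi> ^^ s) (Min V) = (\<phi> ^^ t) (Min V) \<longleftrightarrow> s mod card V = t mod card V"
    using funpow_eq_iff_mod_least_power[OF per] c by simp
  show "card V dvd p ^ N"
    unfolding c by (rule least_power_minimal[OF per(1)])
  show "(\<phi> ^^ t) (Min V) \<in> V"
    using o(2) by (metis (mono_tags, lifting) mem_Collect_eq vertex_orbit_def)
  show "(\<phi> ^^ t) (Min V) < n"
    by (rule funpow_less[OF o(1)])
qed

lemma orbit_cases:
  assumes "v < n"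
  obtains V t where "V \<in> set Vs" "v \<in> V" "v = (\<phi> ^^ t) (Min V)"
proof -
  let ?V = "vertex_orbit \<phi> v"
  have V: "?V \<in> set Vs" "v \<in> ?V"
    using orbit_mem[OF assms] vertex_orbit_refl by auto
  then have "v \<in> (\<lambda>t. (\<phi> ^^ t) (Min ?V)) ` {..<card ?V}"
    using subsetD[OF equalityD1[OF orbit_eq_image[OF V(1)]]] by blast
  then show thesis
    using that[OF V] by blast
qed

text \<open>Both numbers divide \<open>p ^ N\<close>, so both are powers of \<open>p\<close>, for
  which size and divisibility agree. This turns the length bound selecting the columns into the
  divisibility that makes the Fourier vectors well behaved.\<close>

lemma le_card_iff_dvd:
  assumes "V \<in> set Vs" "m dvd p ^ N"
  shows "m \<le> card V \<longleftrightarrow> m dvd card V"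
proof -
  obtain i j where ij: "m = p ^ i" "card V = p ^ j"
    using card_orbit_dvd[OF assms(1)] assms(2) divides_primepow_nat[OF p] by blast
  have "p > 1"
    using prime_gt_1_nat[OF p] .
  then show ?thesis
    unfolding ij by (simp add: dvd_power_iff_le)
qed

section \<open>Fourier vectors as eigenvectors of the shift\<close>

lemma F_carrier [simp]: "F m a V \<in> carrier_vec n"
  by (simp add: orbit_fourier_vec_def)

lemma dim_F [simp]: "dim_vec (F m a V) = n"
  by (simp add: orbit_fourier_vec_def)

lemma F_outside: "v < n \<Longrightarrow> v \<notin> V \<Longrightarrow> F m a V $ v = 0"
  by (simp add: orbit_fourier_vec_def)

text \<open>The least exponent in the definition may be replaced by any other: two exponents
  reaching the same vertex differ by a multiple of \<open>card V\<close>, hence of \<open>m\<close>,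
  and \<open>\<omega> m a ^ m = 1\<close>.\<close>

lemma F_funpow:
  assumes V: "V \<in> set Vs" and m: "m > 0" "m dvd card V"
  shows "F m a V $ ((\<phi> ^^ t) (Min V)) = \<omega> m a ^ t"
proof -
  define s where "s = (LEAST s. (\<phi> ^^ s) (Min V) = (\<phi> ^^ t) (Min V))"
  have "(\<phi> ^^ s) (Min V) = (\<phi> ^^ t) (Min V)"
    unfolding s_def by (rule LeastI[of _ t]) simp
  then have "s mod card V = t mod card V"
    using funpow_Min_eq_iff[OF V] by simp
  then have st: "s mod m = t mod m"
    using mod_mod_cancel[OF m(2), of s] mod_mod_cancel[OF m(2), of t] by simp
  have period: "\<omega> m a ^ k = \<omega> m a ^ (k mod m)" for k
  proof -
    have "\<omega> m a ^ m = 1"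
      using cis_root_power_eq_1_iff[OF m(1), of "a * m"] by (simp add: power_mult)
    then have "\<omega> m a ^ (m * (k div m) + k mod m) = \<omega> m a ^ (k mod m)"
      by (simp only: power_add power_mult power_one mult_1)
    then show ?thesis
      by simp
  qed
  have "F m a V $ ((\<phi> ^^ t) (Min V)) = \<omega> m a ^ s"
    using funpow_Min_mem[OF V] funpow_Min_less[OF V]
    by (simp add: orbit_fourier_vec_def s_def power_mult)
  then show ?thesis
    using period[of s] period[of t] st by simp
qed

lemma F_shift:
  assumes V: "V \<in> set Vs" and m: "m > 0" "m dvd card V" and v: "v < n"
  shows "F m a V $ (\<phi> v) = \<omega> m a * F m a V $ v"
proof -
  obtain W t where W: "W \<in> set Vs" "v \<in> W" "v = (\<phi> ^^ t) (Min W)"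
    using orbit_cases[OF v] by blast
  have v': "\<phi> v = (\<phi> ^^ Suc t) (Min W)"
    using W(3) by simp
  show ?thesis
  proof (cases "W = V")
    case True
    then show ?thesis
      using F_funpow[OF V m, of a "Suc t"] F_funpow[OF V m, of a t] v' W(3) by simp
  next
    case False
    have "v \<notin> V" "\<phi> v \<notin> V"
      using False orbits_disjoint[OF V W(1)] W(2) funpow_Min_mem[OF W(1), of "Suc t"] v' by auto
    then show ?thesis
      using v map_less by (simp add: F_outside)
  qed
qed

text \<open>Lets the indicator columns be treated as Fourier vectors for the root 1.\<close>

lemma F_trivial: "F 1 0 V = vec n (indicator V)"
  by (rule eq_vecI) (auto simp: orbit_fourier_vec_def)

section \<open>Indexing and number of the basis vectors\<close>

lemma orbit_nonempty: "V \<in> set Vs \<Longrightarrow> 1 \<le> card V"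
  using Min_mem[of V] orbit_finite[of V] card_gt_0_iff[of V] by (auto simp: Suc_le_eq)

lemma Union_orbits: "\<Union> (set Vs) = {..<n}"
proof (intro equalityI subsetI)
  fix v assume "v \<in> \<Union> (set Vs)"
  then obtain V where "V \<in> set Vs" "v \<in> V"
    by blast
  then show "v \<in> {..<n}"
    using orbit_of_mem(1) by simp
next
  fix v assume "v \<in> {..<n}"
  then have "vertex_orbit \<phi> v \<in> set Vs"
    using orbit_mem by simp
  then show "v \<in> \<Union> (set Vs)"
    using vertex_orbit_refl[of v \<phi>] by blast
qed

text \<open>The pair \<open>(m, a)\<close> stands for \<open>\<omega> m a\<close>. The list runs
  through all \<open>p ^ N\<close>-th roots of unity, with the fraction \<open>a / m\<close> in
  lowest terms, in the order of the columns of the basis matrix.\<close>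

definition roots :: "(nat \<times> nat) list" where
  "roots = (1, 0) # concat (map (\<lambda>m. map (Pair m) (filter (\<lambda>a. coprime a p) [1..<m]))
     (map (\<lambda>i. p ^ (N - i + 1)) [1..<N + 1]))"

text \<open>Indices are listed instead of vectors, so that columns can be counted and told apart
  before their independence is known.\<close>

definition col_indices :: "((nat \<times> nat) \<times> nat set) list" where
  "col_indices = concat (map (\<lambda>k. map (Pair k) (filter (\<lambda>V. fst k \<le> card V) Vs)) roots)"

lemma one_less_p: "1 < p"
  using prime_gt_1_nat[OF p] .

lemma orbit_basis_matrix_eq:
  "orbit_basis_matrix n p N \<phi> Vs = mat_of_cols n (map (\<lambda>((m, a), V). F m a V) col_indices)"
proof -
  have "filter (\<lambda>V. Suc 0 \<le> card V) Vs = Vs"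
    using orbit_nonempty by (intro filter_True) auto
  then show ?thesis
    using F_trivial
    by (simp add: orbit_basis_matrix_def col_indices_def roots_def map_concat concat_concat o_def
        del: upt_Suc)
qed

lemma set_roots: "set roots = {(m, a). m dvd p ^ N \<and> a < m \<and> coprime a m}"
proof (intro equalityI subsetI)
  fix k assume "k \<in> set roots"
  then consider "k = (1, 0)"
    | i a where "i \<in> {1..<N + 1}" "k = (p ^ (N - i + 1), a)" "coprime a p" "a < p ^ (N - i + 1)"
    unfolding roots_def by (auto simp del: upt_Suc)
  then show "k \<in> {(m, a). m dvd p ^ N \<and> a < m \<and> coprime a m}"
  proof cases
    case 2
    have "p ^ (N - i + 1) dvd p ^ N"
      using 2(1) by (intro le_imp_power_dvd) auto
    with 2 show ?thesis
      by (simp del: power_Suc add: coprime_commute)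
  qed auto
next
  fix k assume "k \<in> {(m, a). m dvd p ^ N \<and> a < m \<and> coprime a m}"
  then obtain m a where k: "k = (m, a)" "m dvd p ^ N" "a < m" "coprime a m"
    by auto
  then obtain j where j: "j \<le> N" "m = p ^ j"
    using divides_primepow_nat[OF p] by blast
  show "k \<in> set roots"
  proof (cases "j = 0")
    case True
    then show ?thesis
      using k j by (simp add: roots_def)
  next
    case False
    have "a \<noteq> 0"
      using k(4) j(2) False one_less_p by (auto intro: ccontr)
    moreover have "coprime a p"
      using k(4) j(2) False by simp
    \<comment> \<open>The index \<open>i = N + 1 - j\<close> solves \<open>N - i + 1 = j\<close>; it
      lies in the range because \<open>1 \<le> j \<le> N\<close>.\<close>
    moreover have "N + 1 - j \<in> set [1..<N + 1]" "m = p ^ (N - (N + 1 - j) + 1)"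
      using j False by auto
    ultimately have "(m, a) \<in> set (concat (map (\<lambda>m. map (Pair m) (filter (\<lambda>a. coprime a p) [1..<m]))
        (map (\<lambda>i. p ^ (N - i + 1)) [1..<N + 1])))"
      using k(3) unfolding set_concat set_map image_image UN_iff
      by (intro bexI[of _ "N + 1 - j"]) (auto simp del: upt_Suc)
    then show ?thesis
      unfolding roots_def k(1) by (rule list.set_intros(2))
  qed
qed

lemma roots_cases:
  assumes "(m, a) \<in> set roots"
  shows "m > 0" "m dvd p ^ N" "a < m" "coprime a m"
  using assms unfolding set_roots by auto

lemma distinct_roots: "distinct roots"
proof -
  have "inj_on (\<lambda>i. p ^ (N - i + 1)) (set [1..<N + 1])"
    using one_less_p by (auto simp: inj_on_def)
  then have "distinct (map (\<lambda>i. p ^ (N - i + 1)) [1..<N + 1])"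
    by (simp only: distinct_map distinct_upt simp_thms)
  then show ?thesis
    unfolding roots_def distinct.simps(2)
    by (intro conjI distinct_concat_map_Pair) auto
qed

lemma distinct_col_indices: "distinct col_indices"
  unfolding col_indices_def
  by (intro distinct_concat_map_Pair distinct_roots distinct_filter distinct_Vs)

lemma set_col_indices:
  "set col_indices = (SIGMA k:set roots. {V \<in> set Vs. fst k \<le> card V})"
  by (auto simp: col_indices_def)

text \<open>The roots used on an orbit of length \<open>c\<close> are exactly the
  \<open>c\<close>-th roots of unity. Grouping them by order \<open>m\<close> gives the sum of
  \<open>totient m\<close> over the divisors of \<open>c\<close>, which is \<open>c\<close>.\<close>

lemma card_roots_le_orbit:
  assumes V: "V \<in> set Vs"
  shows "card {k \<in> set roots. fst k \<le> card V} = card V"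
proof -
  have *: "(m, a) \<in> set roots \<and> m \<le> card V \<longleftrightarrow> m dvd card V \<and> a < m \<and> coprime a m" for m a
    using le_card_iff_dvd[OF V, of m] dvd_trans[OF _ card_orbit_dvd[OF V], of m]
    unfolding set_roots by auto
  have "{k \<in> set roots. fst k \<le> card V} =
      (SIGMA m:{m. m dvd card V}. {a. a < m \<and> coprime a m})"
    by (rule Set.set_eqI) (simp only: * mem_Collect_eq mem_Sigma_iff split_paired_all fst_conv)
  also have "card \<dots> = (\<Sum>m | m dvd card V. card {a. a < m \<and> coprime a m})"
    using orbit_nonempty[OF V] by (intro card_SigmaI) auto
  also have "\<dots> = (\<Sum>m | m dvd card V. totient m)"
    using orbit_nonempty[OF V]
    by (intro sum.cong refl card_coprime_less_eq_totient) (auto intro: Nat.gr0I)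
  finally show ?thesis
    by (simp add: totient_divisor_sum)
qed

lemma length_col_indices: "length col_indices = n"
proof -
  have "length col_indices = card (set col_indices)"
    by (simp add: distinct_card distinct_col_indices)
  also have "\<dots> = (\<Sum>k\<in>set roots. \<Sum>V\<in>set Vs. if fst k \<le> card V then 1 else 0)"
    unfolding set_col_indices by (simp add: sum.If_cases Int_def)
  \<comment> \<open>Double counting: for each orbit the inner sum is its length, and the orbits
    partition the vertex set.\<close>
  also have "\<dots> = (\<Sum>V\<in>set Vs. \<Sum>k\<in>set roots. if fst k \<le> card V then 1 else 0)"
    by (rule sum.swap)
  also have "\<dots> = (\<Sum>V\<in>set Vs. card V)"
    using card_roots_le_orbit by (intro sum.cong refl) (simp add: sum.If_cases Int_def)
  also have "\<dots> = card (\<Union> (set Vs))"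
    using orbit_finite orbits_disjoint
    by (intro card_Union_disjoint[symmetric]) (auto simp: pairwise_def disjnt_def)
  also have "\<Union> (set Vs) = {..<n}"
    by (rule Union_orbits)
  finally show ?thesis
    by simp
qed

section \<open>Orthogonality and invertibility of the basis\<close>

lemma F_orthogonal:
  assumes V: "V \<in> set Vs" and k: "(m, a) \<in> set roots" "m \<le> card V"
    and W: "W \<in> set Vs" and l: "(m', a') \<in> set roots" "m' \<le> card W"
  shows "(\<Sum>v<n. cnj (F m a V $ v) * F m' a' W $ v) =
    (if ((m, a), V) = ((m', a'), W) then of_nat (card V) else 0)"
proof (cases "V = W")
  case False
  have "cnj (F m a V $ v) * F m' a' W $ v = 0" if "v < n" for v
  proof -
    have "v \<notin> V \<or> v \<notin> W"
      using orbits_disjoint[OF V W] False by blast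
    then show ?thesis
      using F_outside[OF that] by auto
  qed
  then have "(\<Sum>v<n. cnj (F m a V $ v) * F m' a' W $ v) = 0"
    by (intro sum.neutral ballI) (simp only: lessThan_iff)
  then show ?thesis
    using False by simp
next
  case True
  note m = roots_cases[OF k(1)] and m' = roots_cases[OF l(1)]
  have dvd: "m dvd card V" "m' dvd card V"
    using le_card_iff_dvd[OF V] m(2) m'(2) k(2) l(2) True by auto
  \<comment> \<open>On a common orbit the Hermitian product is a geometric sum with ratio
    \<open>q\<close>. As \<open>q ^ card V = 1\<close>, it vanishes unless \<open>q = 1\<close>, and
    \<open>q = 1\<close> makes the two roots equal.\<close>
  define q where "q = cnj (\<omega> m a) * \<omega> m' a'"
  have unit: "cnj (\<omega> m a) * \<omega> m a = 1"
    by (simp add: cis_cnj cis_mult flip: power_mult_distrib)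
  have "(\<Sum>v<n. cnj (F m a V $ v) * F m' a' W $ v) = (\<Sum>v\<in>V. cnj (F m a V $ v) * F m' a' V $ v)"
    unfolding True[symmetric]
  proof (rule sum.mono_neutral_right)
    show "V \<subseteq> {..<n}"
      using orbit_of_mem(1)[OF V] by blast
  qed (auto simp: F_outside)
  also have "\<dots> = (\<Sum>v\<in>(\<lambda>t. (\<phi> ^^ t) (Min V)) ` {..<card V}. cnj (F m a V $ v) * F m' a' V $ v)"
    by (rule sum.cong[OF orbit_eq_image[OF V] refl])
  also have "\<dots> = (\<Sum>t<card V. cnj (F m a V $ ((\<phi> ^^ t) (Min V))) * F m' a' V $ ((\<phi> ^^ t) (Min V)))"
    by (simp add: sum.reindex[OF orbit_inj_on[OF V]])
  also have "\<dots> = (\<Sum>t<card V. q ^ t)"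
    using F_funpow[OF V m(1) dvd(1), of a] F_funpow[OF V m'(1) dvd(2), of a']
    by (simp add: q_def power_mult_distrib)
  also have "\<dots> = (if (m, a) = (m', a') then of_nat (card V) else 0)"
  proof (cases "(m, a) = (m', a')")
    case True
    then have "q = 1"
      using unit by (simp add: q_def)
    then show ?thesis
      using True by simp
  next
    case False
    have "q \<noteq> 1"
    proof
      assume "q = 1"
      then have "\<omega> m a = \<omega> m a * q"
        by simp
      also have "\<dots> = \<omega> m' a'"
        using unit by (simp add: q_def mult.commute mult.left_commute)
      finally show False
        using primitive_root_inject[OF m(3,4) m'(3,4)] False by simp
    qed
    moreover have "q ^ card V = 1"
    proof -
      have "\<omega> m a ^ card V = 1" "\<omega> m' a' ^ card V = 1"
        using primitive_root_power_eq_1_iff[OF m(1,4)] primitive_root_power_eq_1_iff[OF m'(1,4)] dvd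
        by auto
      then show ?thesis
        unfolding q_def power_mult_distrib complex_cnj_power[symmetric] by simp
    qed
    ultimately show ?thesis
      using geometric_sum[of q "card V"] False by auto
  qed
  finally show ?thesis
    using True by simp
qed

lemma orbit_basis_matrix_invertible:
  obtains T' where "T' \<in> carrier_mat n n" "orbit_basis_matrix n p N \<phi> Vs \<in> carrier_mat n n"
    "orbit_basis_matrix n p N \<phi> Vs * T' = 1\<^sub>m n" "T' * orbit_basis_matrix n p N \<phi> Vs = 1\<^sub>m n"
proof -
  let ?T = "orbit_basis_matrix n p N \<phi> Vs"
  \<comment> \<open>By orthogonality the inverse is the conjugate transpose with each row divided by
    the length of its orbit, the squared norm of the column.\<close>
  define T' where "T' = mat n n (\<lambda>(j, v). case col_indices ! j of ((m, a), V) \<Rightarrow>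
    cnj (F m a V $ v) / of_nat (card V))"
  have T: "?T \<in> carrier_mat n n"
    unfolding orbit_basis_matrix_eq by (rule carrier_matI) (simp_all add: length_col_indices)
  have T': "T' \<in> carrier_mat n n"
    by (simp add: T'_def)
  have "T' * ?T = 1\<^sub>m n"
  proof (rule eq_matI)
    fix i j assume "i < dim_row (1\<^sub>m n :: complex mat)" "j < dim_col (1\<^sub>m n :: complex mat)"
    then have ij: "i < n" "j < n"
      by auto
    obtain m a V where i': "col_indices ! i = ((m, a), V)"
      by (cases "col_indices ! i") auto
    obtain m' a' W where j': "col_indices ! j = ((m', a'), W)"
      by (cases "col_indices ! j") auto
    have i: "V \<in> set Vs" "(m, a) \<in> set roots" "m \<le> card V"
      using nth_mem[of i col_indices] ij length_col_indices unfolding i' set_col_indices by auto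
    have j: "W \<in> set Vs" "(m', a') \<in> set roots" "m' \<le> card W"
      using nth_mem[of j col_indices] ij length_col_indices unfolding j' set_col_indices by auto
    have eq: "((m, a), V) = ((m', a'), W) \<longleftrightarrow> i = j"
      using nth_eq_iff_index_eq[OF distinct_col_indices, of i j] ij length_col_indices i' j' by simp
    have "(T' * ?T) $$ (i, j) = (\<Sum>v<n. cnj (F m a V $ v) / of_nat (card V) * F m' a' W $ v)"
      using ij i' j' T length_col_indices
      by (simp add: T'_def scalar_prod_def orbit_basis_matrix_eq mat_of_cols_index atLeast0LessThan)
    also have "\<dots> = (\<Sum>v<n. cnj (F m a V $ v) * F m' a' W $ v) / of_nat (card V)"
      by (simp add: sum_divide_distrib)
    also have "\<dots> = (if i = j then 1 else 0)"
      unfolding F_orthogonal[OF i j] eq using orbit_nonempty[OF i(1)] by simp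
    finally show "(T' * ?T) $$ (i, j) = 1\<^sub>m n $$ (i, j)"
      using ij by simp
  qed (use T T' in auto)
  moreover have "?T * T' = 1\<^sub>m n"
    by (rule mat_mult_left_right_inverse[OF T' T \<open>T' * ?T = 1\<^sub>m n\<close>])
  ultimately show thesis
    using that T T' by blast
qed

end

section \<open>The blocks\<close>

locale invariant_matrix = prime_power_permutation +
  fixes M :: "complex mat"
  assumes M: "M \<in> carrier_mat n n"
    and inv: "\<And>i j. i < n \<Longrightarrow> j < n \<Longrightarrow> M $$ (\<phi> i, \<phi> j) = M $$ (i, j)"
begin

lemma mult_F_index: "v < n \<Longrightarrow> (M *\<^sub>v F m a V) $ v = (\<Sum>u<n. M $$ (v, u) * F m a V $ u)"
  using M by (simp add: scalar_prod_def atLeast0LessThan)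

lemma mult_F_shift:
  assumes "V \<in> set Vs" "m > 0" "m dvd card V" "v < n"
  shows "(M *\<^sub>v F m a V) $ (\<phi> v) = \<omega> m a * (M *\<^sub>v F m a V) $ v"
proof -
  have "(M *\<^sub>v F m a V) $ (\<phi> v) = (\<Sum>u<n. M $$ (\<phi> v, u) * F m a V $ u)"
    by (rule mult_F_index[OF map_less[OF assms(4)]])
  \<comment> \<open>Reindexing the sum along \<phi> lets invariance of \<open>M\<close> remove
    \<phi> from both matrix indices.\<close>
  also have "\<dots> = (\<Sum>u<n. M $$ (\<phi> v, \<phi> u) * F m a V $ (\<phi> u))"
    by (rule sum.reindex_bij_betw[OF bij, symmetric])
  also have "\<dots> = (\<Sum>u<n. \<omega> m a * (M $$ (v, u) * F m a V $ u))"
    using assms by (intro sum.cong) (simp_all add: inv F_shift)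
  finally show ?thesis
    using assms(4) by (simp add: mult_F_index sum_distrib_left)
qed

lemma mult_F_funpow:
  assumes "V \<in> set Vs" "m > 0" "m dvd card V" "v < n"
  shows "(M *\<^sub>v F m a V) $ ((\<phi> ^^ t) v) = \<omega> m a ^ t * (M *\<^sub>v F m a V) $ v"
proof (induction t)
  case (Suc t)
  then show ?case
    using mult_F_shift[OF assms(1-3) funpow_less[OF assms(4)], of a t] by simp
qed simp

abbreviation long_orbits :: "nat \<Rightarrow> nat set list" where
  "long_orbits m \<equiv> filter (\<lambda>V. m \<le> card V) Vs"

text \<open>Each Fourier vector has value 1 at the base point of its orbit, so the coefficient of
  the orbit \<open>W\<close> in an expansion is simply the value at \<open>Min W\<close>.\<close>

definition eigen_block :: "nat \<Rightarrow> nat \<Rightarrow> complex mat" where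
  "eigen_block m a = mat (length (long_orbits m)) (length (long_orbits m))
     (\<lambda>(k, l). (M *\<^sub>v F m a (long_orbits m ! l)) $ Min (long_orbits m ! k))"

text \<open>
  \<open>M\<close> commutes with the shift by \<open>\<phi>\<close>, so \<open>M *\<^sub>v F m a V\<close> is an eigenvector of the shift for
  \<open>\<omega> m a\<close>. Going once around an orbit of length less than \<open>m\<close> shows that it vanishes there.
\<close>

lemma mult_F_expand:
  assumes V: "V \<in> set Vs" and m: "m dvd p ^ N" "m \<le> card V" and a: "coprime a m" and v: "v < n"
  shows "(M *\<^sub>v F m a V) $ v =
    (\<Sum>W\<in>set (long_orbits m). F m a W $ v * (M *\<^sub>v F m a V) $ Min W)"
proof -
  have m0: "m > 0"
    using m(1) order_pos by (rule dvd_pos_nat[rotated])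
  have mV: "m dvd card V"
    using le_card_iff_dvd[OF V m(1)] m(2) by simp
  obtain U t where U: "U \<in> set Vs" "v \<in> U" "v = (\<phi> ^^ t) (Min U)"
    using orbit_cases[OF v] by blast
  have other: "F m a W $ v = 0" if "W \<in> set Vs" "W \<noteq> U" for W
    using that U(1,2) orbits_disjoint F_outside[OF v] by blast
  have Min_U: "Min U < n"
    using orbit_of_mem(1)[OF U(1) Min_mem[OF U(1)]] .
  note g = mult_F_funpow[OF V m0 mV Min_U, of a]
  show ?thesis
  proof (cases "m \<le> card U")
    case True
    \<comment> \<open>Only the orbit \<open>U\<close> of \<open>v\<close> contributes: its term is
      \<open>\<omega> m a ^ t\<close> times the value at \<open>Min U\<close>, which the eigenvector
      property carries to \<open>v\<close>.\<close>
    have "(\<Sum>W\<in>set (long_orbits m). F m a W $ v * (M *\<^sub>v F m a V) $ Min W)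
      = (\<Sum>W\<in>{U}. F m a W $ v * (M *\<^sub>v F m a V) $ Min W)"
      using True U(1) other by (intro sum.mono_neutral_right) auto
    then show ?thesis
      using F_funpow[OF U(1) m0, of a t] g[of t] le_card_iff_dvd[OF U(1) m(1)] True U(3) by simp
  next
    case False
    have "(\<phi> ^^ card U) (Min U) = Min U"
      using funpow_Min_eq_iff[OF U(1), of "card U" 0] by simp
    then have "(M *\<^sub>v F m a V) $ Min U = \<omega> m a ^ card U * (M *\<^sub>v F m a V) $ Min U"
      using g[of "card U"] by simp
    moreover have "\<omega> m a ^ card U \<noteq> 1"
      using primitive_root_power_eq_1_iff[OF m0 a] False le_card_iff_dvd[OF U(1) m(1)] by simp
    ultimately have "(M *\<^sub>v F m a V) $ Min U = 0"
      by simp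
    moreover have "(\<Sum>W\<in>set (long_orbits m). F m a W $ v * (M *\<^sub>v F m a V) $ Min W) = 0"
      using False other by (intro sum.neutral) auto
    ultimately show ?thesis
      using g[of t] U(3) by simp
  qed
qed

text \<open>Column \<open>l\<close> of the block holds the coordinates of the image of the
  \<open>l\<close>-th Fourier vector, as given by \<open>mult_F_expand\<close>.\<close>

lemma invariant_cols_eigen_block:
  assumes m: "m dvd p ^ N" and a: "coprime a m"
  shows "invariant_cols n M (map (F m a) (long_orbits m)) (eigen_block m a)"
proof -
  let ?W = "long_orbits m" and ?cs = "map (F m a) (long_orbits m)"
  have "M * mat_of_cols n ?cs = mat_of_cols n ?cs * eigen_block m a"
  proof (rule eq_matI)
    fix v l
    assume "v < dim_row (mat_of_cols n ?cs * eigen_block m a)"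
      and "l < dim_col (mat_of_cols n ?cs * eigen_block m a)"
    then have v: "v < n" and l: "l < length ?W"
      by (auto simp: eigen_block_def)
    let ?V = "?W ! l"
    have V: "?V \<in> set Vs" "m \<le> card ?V"
      using nth_mem[OF l] by auto
    have "(M * mat_of_cols n ?cs) $$ (v, l) = (M *\<^sub>v F m a ?V) $ v"
      using M v l by (simp add: col_mat_of_cols)
    also have "\<dots> = (\<Sum>W\<in>set ?W. F m a W $ v * (M *\<^sub>v F m a ?V) $ Min W)"
      by (rule mult_F_expand[OF V(1) m V(2) a v])
    also have "\<dots> = (\<Sum>k<length ?W. F m a (?W ! k) $ v * (M *\<^sub>v F m a ?V) $ Min (?W ! k))"
      by (rule sum.reindex_bij_betw[symmetric])
        (rule bij_betw_nth, use distinct_Vs in auto)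
    also have "\<dots> = (mat_of_cols n ?cs * eigen_block m a) $$ (v, l)"
      using v l by (simp add: scalar_prod_def eigen_block_def mat_of_cols_index atLeast0LessThan)
    finally show "(M * mat_of_cols n ?cs) $$ (v, l) = (mat_of_cols n ?cs * eigen_block m a) $$ (v, l)" .
  qed (use M in \<open>auto simp: eigen_block_def\<close>)
  then show ?thesis
    by (simp add: invariant_cols_def eigen_block_def)
qed

lemma long_orbits_1: "long_orbits 1 = Vs"
  using orbit_nonempty by (intro filter_True) blast

text \<open>Applying \<open>M\<close> to the indicator vector of a cell gives the row sums over that
  cell. For the root 1 the eigenvector property says that these are constant on orbits, so the value
  at the base point represents all of them.\<close>

lemma is_divisor_matrix_eigen_block: "is_divisor_matrix n M Vs (eigen_block 1 0)"
proof -
  have "partition_on {..<n} (set Vs)"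
  proof (rule partition_onI)
    show "\<Union> (set Vs) = {..<n}"
      by (rule Union_orbits)
    show "disjnt V W" if "V \<in> set Vs" "W \<in> set Vs" "V \<noteq> W" for V W
      using orbits_disjoint[OF that(1,2)] that(3) unfolding disjnt_def by blast
    show "{} \<notin> set Vs"
      using Min_mem by blast
  qed
  moreover have "(\<Sum>t\<in>Vs ! j. M $$ (s, t)) = eigen_block 1 0 $$ (i, j)"
    if i: "i < length Vs" and j: "j < length Vs" and s: "s \<in> Vs ! i" for i j s
  proof -
    note Vi = nth_mem[OF i] and Vj = nth_mem[OF j]
    have sn: "s < n"
      by (rule orbit_of_mem(1)[OF Vi s])
    obtain t where t: "s = (\<phi> ^^ t) (Min (Vs ! i))"
      using subsetD[OF equalityD1[OF orbit_eq_image[OF Vi]] s] by blast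
    have "(M *\<^sub>v F 1 0 (Vs ! j)) $ s = (\<Sum>t<n. M $$ (s, t) * indicator (Vs ! j) t)"
      unfolding mult_F_index[OF sn] by (intro sum.cong refl) (simp add: F_trivial[unfolded One_nat_def])
    also have "\<dots> = (\<Sum>t\<in>Vs ! j. M $$ (s, t))"
      using orbit_of_mem(1)[OF Vj] by (intro sum.mono_neutral_cong_right) auto
    finally have "(\<Sum>t\<in>Vs ! j. M $$ (s, t)) = (M *\<^sub>v F 1 0 (Vs ! j)) $ s"
      by simp
    also have "\<dots> = (M *\<^sub>v F 1 0 (Vs ! j)) $ Min (Vs ! i)"
      using mult_F_funpow[OF Vj, of 1 "Min (Vs ! i)" 0 t]
        orbit_of_mem(1)[OF Vi Min_mem[OF Vi]] t by simp
    finally show ?thesis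
      unfolding eigen_block_def long_orbits_1 using i j by simp
  qed
  ultimately show ?thesis
    using distinct_Vs unfolding is_divisor_matrix_def
    by (simp add: eigen_block_def long_orbits_1[unfolded One_nat_def])
qed

end

section \<open>Assembling the similarity from the eigenspaces\<close>

theorem theorem3p4:
  fixes G :: "nat pair_pre_digraph"
    and w :: "nat \<times> nat \<Rightarrow> 'w"
    and M :: "complex mat"
    and \<phi> :: "nat \<Rightarrow> nat"
    and n p N :: nat
    and r :: "nat \<Rightarrow> nat"
    and Vs :: "nat set list"
  assumes "pair_wf_digraph G" and "pverts G = {..<n}"
    and "graph_automorphism G w \<phi>"
    and "prime p" and "N \<ge> 1"
    and "automorphism_order (pverts G) \<phi> = p ^ N"
    and "M \<in> carrier_mat n n"
    and "automorphism_compatible G w M"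
    and "\<And>i. i \<in> {1..N} \<Longrightarrow>
           r i = card {V \<in> vertex_orbits (pverts G) \<phi>. card V \<ge> p ^ (N - i + 1)}"
    and "distinct Vs" and "set Vs = vertex_orbits (pverts G) \<phi>"
  shows "\<exists>M\<^sub>\<phi> B T'.
    is_divisor_matrix n M Vs M\<^sub>\<phi> \<and>
    (\<forall>i\<in>{1..N}. \<forall>j\<in>{1..p ^ (N - i + 1) - p ^ (N - i)}. B i j \<in> carrier_mat (r i) (r i)) \<and>
    similar_mat_wit M
      (diag_block_mat
        (M\<^sub>\<phi> # map (\<lambda>i. diag_block_mat (map (B i) [1..<p ^ (N - i + 1) - p ^ (N - i) + 1]))
                  [1..<N + 1]))
      (orbit_basis_matrix n p N \<phi> Vs) T'"
proof -
  have bij: "bij_betw \<phi> {..<n} {..<n}"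
    using assms(2,3) by (simp add: graph_automorphism_def)
  interpret invariant_matrix n p N \<phi> Vs M
  proof
    show "(\<phi> ^^ p ^ N) v = v" if "v < n" for v
      using automorphism_order_period[of "pverts G" \<phi> v] that bij assms(2,6) by simp
    show "M $$ (\<phi> i, \<phi> j) = M $$ (i, j)" if "i < n" "j < n" for i j
      using assms(2,3,8) that unfolding automorphism_compatible_def by simp
  qed (use assms bij in auto)
  define coprimes where "coprimes i = filter (\<lambda>a. coprime a p) [1..<p ^ (N - i + 1)]" for i
  \<comment> \<open>The j-th block belongs to the j-th exponent of a primitive root. Its size
    depends on \<open>i\<close> alone, so \<open>B_carrier\<close> holds for every
    \<open>j\<close>.\<close>
  define B where "B i j = eigen_block (p ^ (N - i + 1)) (coprimes i ! (j - 1))" for i j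
  define D where "D = diag_block_mat (eigen_block 1 0 # map (\<lambda>i. diag_block_mat (map (B i)
    [1..<p ^ (N - i + 1) - p ^ (N - i) + 1])) [1..<N + 1])"
  let ?T = "orbit_basis_matrix n p N \<phi> Vs"
  have len: "p ^ (N - i + 1) - p ^ (N - i) = length (coprimes i)" for i
    using length_coprime_prime_power[OF p, of "N - i + 1"] by (simp add: coprimes_def)
  have B_list: "map (B i) [1..<p ^ (N - i + 1) - p ^ (N - i) + 1] =
      map (eigen_block (p ^ (N - i + 1))) (coprimes i)" for i
    unfolding len B_def by (rule map_nth_shift)
  have B_carrier: "B i j \<in> carrier_mat (r i) (r i)" if "i \<in> {1..N}" for i j
  proof -
    have "r i = card (set (long_orbits (p ^ (N - i + 1))))"
      unfolding assms(9)[OF that] set_filter set_Vs assms(2) ..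
    also have "\<dots> = length (long_orbits (p ^ (N - i + 1)))"
      using distinct_Vs by (intro distinct_card) simp
    finally show ?thesis
      by (simp add: B_def eigen_block_def)
  qed
  let ?cols = "\<lambda>i a. map (F (p ^ (N - i + 1)) a) (long_orbits (p ^ (N - i + 1)))"
  have block: "invariant_cols n M (concat (map (?cols i) (coprimes i)))
      (diag_block_mat (map (eigen_block (p ^ (N - i + 1))) (coprimes i)))"
    if "i \<in> set [1..<N + 1]" for i
  proof (rule invariant_cols_concat[OF M])
    have "p ^ (N - i + 1) dvd p ^ N"
      using that by (intro le_imp_power_dvd) auto
    then show "list_all2 (invariant_cols n M) (map (?cols i) (coprimes i))
        (map (eigen_block (p ^ (N - i + 1))) (coprimes i))"
      unfolding list_all2_map1 list_all2_map2 coprimes_def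
      by (intro list_all2_same[THEN iffD2] ballI invariant_cols_eigen_block) auto
  qed
  have "invariant_cols n M (map (F 1 0) (long_orbits 1)) (eigen_block 1 0)"
    by (rule invariant_cols_eigen_block) auto
  then have "invariant_cols n M (map (\<lambda>V. vec n (indicator V)) Vs) (eigen_block 1 0)"
    unfolding long_orbits_1 F_trivial[abs_def] .
  moreover have "list_all2 (invariant_cols n M)
      (map (\<lambda>i. concat (map (?cols i) (coprimes i))) [1..<N + 1])
      (map (\<lambda>i. diag_block_mat (map (B i) [1..<p ^ (N - i + 1) - p ^ (N - i) + 1])) [1..<N + 1])"
    unfolding list_all2_map1 list_all2_map2 B_list
    by (intro list_all2_same[THEN iffD2] ballI block)
  ultimately have "invariant_cols n M (concat (map (\<lambda>V. vec n (indicator V)) Vs #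
      map (\<lambda>i. concat (map (?cols i) (coprimes i))) [1..<N + 1])) D"
    unfolding D_def by (intro invariant_cols_concat[OF M] list_all2_Cons[THEN iffD2] conjI)
  then have "invariant_cols n M (map (\<lambda>V. vec n (indicator V)) Vs @
      concat (map (\<lambda>i. concat (map (?cols i) (coprimes i))) [1..<N + 1])) D"
    by (simp only: concat.simps)
  \<comment> \<open>The collected columns are those of \<open>?T\<close> in their defining
    order.\<close>
  then have MT: "M * ?T = ?T * D" and "dim_col ?T = dim_row D" "dim_col ?T = dim_col D"
    unfolding invariant_cols_def orbit_basis_matrix_def coprimes_def by auto
  moreover obtain T' where T': "T' \<in> carrier_mat n n" "?T \<in> carrier_mat n n"
    "?T * T' = 1\<^sub>m n" "T' * ?T = 1\<^sub>m n"
    by (rule orbit_basis_matrix_invertible)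
  \<comment> \<open>The size of \<open>D\<close> is read off from the number of columns of
    \<open>?T\<close>, which is \<open>n\<close> because \<open>?T\<close> is square.\<close>
  ultimately have D: "D \<in> carrier_mat n n"
    by auto
  have "M = M * (?T * T')"
    using M T'(3) by simp
  also have "\<dots> = ?T * D * T'"
    using MT M T'(1,2) by (simp flip: assoc_mult_mat)
  finally have "similar_mat_wit M D ?T T'"
    using M D T' by (intro similar_mat_witI) auto
  then show ?thesis
    using is_divisor_matrix_eigen_block B_carrier unfolding D_def by blast
qed

end
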